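(* Suppose a random variable $Y$ satisfies the structural causal model $Y = f(X, Z, E)$, where $X$ and $Z$ cause $Y$, $Z$ is a cause of $X$, and $E$ is a noise term (unmeasured factors influencing $Y$) with $E$ independent of $(X,Z)$. Assume that, for some function $g$ of the noise, the (unknown) function $f$ is smooth and strictly monotonic in $g(E)$ for fixed values of $X, Z$. Suppose we have observed $\langle X = x, Y = y, Z = z\rangle$. Then, for any value $x'$, the counterfactual outcome $Y_{X=x'} \mid X=x, Y=y, Z=z$ (what $Y$ would have been had $X$ been set to $x'$, given the observed evidence) is equal to the $\tau$-th quantile of the conditional distribution $P(Y \mid X=x', Z=z)$, where $\tau$ is such that $Y=y$ is the $\tau$-th quantile of $P(Y \mid X=x, Z=z)$, i.e. $\tau = P(Y\le y \mid X=x, Z=z)$.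
   Context: The function $g$ is an arbitrary function of the latent factor $E$; the monotonicity assumption means that $Y$ depends on $E$ through $g(E)$, equivalently $f(X,Z,E)$ can be represented as $f_1(f_2(X,Z), g(E))$, and for each fixed $(X,Z)$ the outcome is strictly monotonic as a function of the value of $g(E)$. Counterfactual outcome (Pearl's three-step procedure, for a single unit): (1) abduction: use the evidence $\langle X=x,Y=y,Z=z\rangle$ to determine the noise value $E=e$, so that $y=f(x,z,e)$ (under the monotonicity assumption the value $g(e)$ is determined); (2) action: replace the structural equation of $X$ by $X=x'$; (3) prediction: the counterfactual outcome is $Y_{X=x'} = f(x', z, e)$. Quantile: the $\tau$-th quantile of a conditional distribution $P(Y\mid X=x,Z=z)$ is the minimum value $\mu$ such that $P(Y\le \mu\mid X=x,Z=z)=\tau$. *)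

theory Defs
  imports "HOL-Probability.Probability"
begin

section \<open>Smooth functions\<close>

text \<open>
  \<open>Ck k f\<close>: all iterated directional derivatives of \<open>f\<close> up to order \<open>k\<close> exist (as total
  derivatives of the preceding ones) and are continuous on the whole space. On a Euclidean space
  this is the usual class \<open>C^k\<close>.
\<close>

primrec Ck :: "nat \<Rightarrow> ('a::euclidean_space \<Rightarrow> 'b::real_normed_vector) \<Rightarrow> bool" where
  "Ck 0 f \<longleftrightarrow> continuous_on UNIV f"
| "Ck (Suc k) f \<longleftrightarrow>
     (\<forall>x. f differentiable (at x)) \<and> (\<forall>v. Ck k (\<lambda>x. frechet_derivative f (at x) v))"

definition smooth :: "('a::euclidean_space \<Rightarrow> 'b::real_normed_vector) \<Rightarrow> bool" where
  "smooth f \<longleftrightarrow> (\<forall>k. Ck k f)"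


section \<open>The structural causal model and counterfactuals\<close>

text \<open>
  Causal graph \<open>Z \<rightarrow> X\<close>, \<open>X \<rightarrow> Y\<close>, \<open>Z \<rightarrow> Y\<close>, with \<open>Z\<close> exogenous. The noise of the equation of
  \<open>X\<close> has an arbitrary type \<open>'u\<close> and will carry no independence assumption, so that the
  equation of \<open>X\<close> is no restriction on the joint law of \<open>(X, Z)\<close>.
\<close>

record ('x, 'z, 'u, 'e) scm =
  eqn_X :: "'z \<Rightarrow> 'u \<Rightarrow> 'x"
  eqn_Y :: "'x \<Rightarrow> 'z \<Rightarrow> 'e \<Rightarrow> real"

definition outcome :: "('x, 'z, 'u, 'e) scm \<Rightarrow> 'z \<Rightarrow> 'u \<Rightarrow> 'e \<Rightarrow> real" where
  "outcome m z u e = eqn_Y m (eqn_X m z u) z e"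

text \<open>
  Pearl's three steps for a single unit. Abduction returns every noise value compatible with the
  evidence, since the noise need not be determined by it; consequently prediction returns the set
  of all outcomes of the modified model for these noise values. The counterfactual outcome is
  well defined when this set is a singleton.
\<close>

definition abduction :: "('x, 'z, 'u, 'e) scm \<Rightarrow> 'x \<Rightarrow> real \<Rightarrow> 'z \<Rightarrow> ('u \<times> 'e) set" where
  "abduction m x y z = {(u, e). eqn_X m z u = x \<and> outcome m z u e = y}"

definition do_X :: "'x \<Rightarrow> ('x, 'z, 'u, 'e) scm \<Rightarrow> ('x, 'z, 'u, 'e) scm" where
  "do_X x' m = m\<lparr>eqn_X := (\<lambda>_ _. x')\<rparr>"

definition counterfactual_outcomes ::
  "('x, 'z, 'u, 'e) scm \<Rightarrow> 'x \<Rightarrow> real \<Rightarrow> 'z \<Rightarrow> 'x \<Rightarrow> real set" where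
  "counterfactual_outcomes m x y z x' =
     (\<lambda>(u, e). outcome (do_X x' m) z u e) ` abduction m x y z"

text \<open>
  For each fixed \<open>(x, z)\<close>, the value \<open>f x z e\<close> depends on \<open>e\<close> only through \<open>g e\<close>, and is a
  strictly monotonic function \<open>h\<close> of it. The direction of monotonicity is not required to be the
  same for all \<open>(x, z)\<close>. Since \<open>h\<close> may vary freely with \<open>(x, z)\<close>, this is the representation
  \<open>f x z e = f1 (f2 x z) (g e)\<close> with \<open>f1 (f2 x z)\<close> strictly monotonic on the values of \<open>g\<close>.
\<close>

definition strictly_monotonic_in_noise ::
  "('x \<Rightarrow> 'z \<Rightarrow> 'e \<Rightarrow> real) \<Rightarrow> ('e \<Rightarrow> real) \<Rightarrow> bool" where
  "strictly_monotonic_in_noise f g \<longleftrightarrow>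
     (\<forall>x z. \<exists>h. (\<forall>e. f x z e = h (g e)) \<and>
        (strict_mono_on (range g) h \<or> strict_antimono_on (range g) h))"


section \<open>Independence, conditional distributions and quantiles\<close>

text \<open>
  The library's \<open>indep_var\<close> forces both variables to have the same type; this is the
  independence of the generated sigma-algebras for variables of different types.
\<close>

definition indep_rv ::
  "'w measure \<Rightarrow> ('w \<Rightarrow> 'a::topological_space) \<Rightarrow> ('w \<Rightarrow> 'b::topological_space) \<Rightarrow> bool" where
  "indep_rv M A B \<longleftrightarrow>
     prob_space.indep_set M
       (sets (vimage_algebra (space M) A borel)) (sets (vimage_algebra (space M) B borel))"

text \<open>
  \<open>K\<close> is a regular conditional distribution of \<open>Y\<close> given \<open>W\<close>, i.e. \<open>K w\<close> is a version of
  \<open>P(Y \<in> \<cdot> | W = w)\<close>. It is unique up to a null set of the law of \<open>W\<close>; at an atom \<open>w\<close> of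
  that law it is the elementary conditional distribution.
\<close>

definition regular_cond_distr ::
  "'w measure \<Rightarrow> ('w \<Rightarrow> real) \<Rightarrow> ('w \<Rightarrow> 'b::topological_space) \<Rightarrow> ('b \<Rightarrow> real measure) \<Rightarrow> bool"
where
  "regular_cond_distr M Y W K \<longleftrightarrow>
     K \<in> borel \<rightarrow>\<^sub>M prob_algebra borel \<and>
     (\<forall>A \<in> sets borel. \<forall>B \<in> sets borel.
        emeasure M {\<omega> \<in> space M. Y \<omega> \<in> A \<and> W \<omega> \<in> B} =
          (\<integral>\<^sup>+ w \<in> B. emeasure (K w) A \<partial>(distr M borel W)))"

definition is_quantile :: "real measure \<Rightarrow> real \<Rightarrow> real \<Rightarrow> bool" where
  "is_quantile N \<tau> \<mu> \<longleftrightarrow> cdf N \<mu> = \<tau> \<and> (\<forall>\<nu>. cdf N \<nu> = \<tau> \<longrightarrow> \<mu> \<le> \<nu>)"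

end

theory Submission
  imports Defs
begin

text \<open>
  For two noise values \<open>a\<close>, \<open>b\<close> the difference \<open>f x z b - f x z a\<close> is continuous in \<open>(x, z)\<close>
  and either vanishes everywhere or nowhere; as the parameter space is connected, its sign is
  constant. So all the functions \<open>f x z\<close> induce the same order on noise values, although the
  direction of monotonicity is not assumed to be uniform. By independence, \<open>K (x, z)\<close> is the law of
  \<open>f x z E\<close> for almost all \<open>(x, z)\<close>. Hence \<open>f x z e\<close> and \<open>f x' z e\<close> sit at the same level of their
  distribution functions. Minimality of the quantile is transferred by the intermediate value
  theorem in the noise variable.
\<close>

section \<open>Invariance of the order on noise values\<close>

text \<open>Strict monotonicity in either direction makes \<open>h'\<close> injective on
  \<open>range g\<close>. Hence whether two noise values are separated depends on their
  \<open>g\<close>-values alone, and not on the parameters.\<close>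

lemma strictly_monotonic_in_noise_less_imp_neq:
  assumes "strictly_monotonic_in_noise f g" and "f x z a < f x z b"
  shows "f x' z' a \<noteq> f x' z' b"
proof -
  obtain h where h: "\<And>e. f x z e = h (g e)"
    using assms(1) unfolding strictly_monotonic_in_noise_def by meson
  obtain h' where h': "\<And>e. f x' z' e = h' (g e)"
    and mono: "strict_mono_on (range g) h' \<or> strict_antimono_on (range g) h'"
    using assms(1) unfolding strictly_monotonic_in_noise_def by meson
  have "g a \<noteq> g b"
    using assms(2) h by auto
  moreover have "inj_on h' (range g)"
    using mono
  proof
    assume "strict_antimono_on (range g) h'"
    then show ?thesis
      by (intro linorder_inj_onI') (metis less_irrefl monotone_on_def)
  qed (rule strict_mono_on_imp_inj_on)
  ultimately show ?thesis
    by (simp add: h' inj_on_eq_iff)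
qed

lemma sign_constant_on_connected:
  fixes d :: "'a::topological_space \<Rightarrow> real"
  assumes "connected S" and "continuous_on S d" and "\<And>w. w \<in> S \<Longrightarrow> d w \<noteq> 0"
    and "v \<in> S" and "w \<in> S" and "0 < d v"
  shows "0 < d w"
proof (rule ccontr)
  assume "\<not> 0 < d w"
  then have "0 \<in> d ` S"
    using connectedD_interval[OF connected_continuous_image[OF assms(2,1)], of "d w" "d v" 0] assms
    by auto
  then show False
    using assms(3) by fastforce
qed

lemma noise_order_invariant:
  fixes f :: "'x::euclidean_space \<Rightarrow> 'z::euclidean_space \<Rightarrow> 'e::euclidean_space \<Rightarrow> real"
  assumes mono: "strictly_monotonic_in_noise f g"
    and cont: "continuous_on UNIV (\<lambda>(x, z, e). f x z e)"
    and less: "f x z a < f x z b"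
  shows "f x' z' a < f x' z' b"
proof -
  have slice: "continuous_on UNIV (\<lambda>w. f (fst w) (snd w) e)" for e
    using continuous_on_compose2[OF cont _ subset_UNIV, of UNIV "\<lambda>w. (fst w, snd w, e)"]
    by (simp add: continuous_intros)
  let ?d = "\<lambda>w. f (fst w) (snd w) b - f (fst w) (snd w) a"
  have "0 < ?d (x', z')"
  proof (rule sign_constant_on_connected[where d = ?d and S = UNIV and v = "(x, z)"])
    show "continuous_on UNIV ?d"
      by (intro continuous_on_diff slice)
    show "?d w \<noteq> 0" for w
      using strictly_monotonic_in_noise_less_imp_neq[OF mono less, of "fst w" "snd w"] by simp
    show "0 < ?d (x, z)"
      using less by simp
  qed (simp_all add: connected_UNIV)
  then show ?thesis by simp
qed

section \<open>Identification of the conditional distribution\<close>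

text \<open>If \<open>F x < G x\<close>, right continuity keeps \<open>F\<close> below
  \<open>G x\<close> just to the right of \<open>x\<close>, while monotonicity keeps
  \<open>G\<close> at or above it; a rational point there is a contradiction. Two uses with the
  roles exchanged give equality.\<close>

lemma right_continuous_le_if_eq_on_Rats:
  fixes F G :: "real \<Rightarrow> real"
  assumes cont: "continuous (at_right x) F" and mono: "mono G"
    and eq: "\<And>q. q \<in> \<rat> \<Longrightarrow> F q = G q"
  shows "G x \<le> F x"
proof (rule ccontr)
  assume "\<not> G x \<le> F x"
  then have "eventually (\<lambda>t. F t < G x) (at_right x)"
    using cont by (intro order_tendstoD(2)) (auto simp: continuous_within)
  then obtain b where "x < b" and b: "\<And>t. x < t \<Longrightarrow> t < b \<Longrightarrow> F t < G x"
    by (auto simp: eventually_at_right_field)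
  obtain q where "q \<in> \<rat>" "x < q" "q < b"
    using Rats_dense_in_real[OF \<open>x < b\<close>] by auto
  then show False
    using b[of q] eq[of q] monoD[OF mono, of x q] by auto
qed

text \<open>Countably many thresholds suffice, so statements that hold almost everywhere for each
  threshold separately can be combined.\<close>

lemma real_distribution_eqI_Rats:
  assumes "real_distribution M1" and "real_distribution M2"
    and eq: "\<And>q. q \<in> \<rat> \<Longrightarrow> cdf M1 q = cdf M2 q"
  shows "M1 = M2"
proof (rule cdf_unique)
  interpret M1: real_distribution M1 by fact
  interpret M2: real_distribution M2 by fact
  have "mono (cdf M1)" and "mono (cdf M2)"
    by (auto intro!: monoI M1.cdf_nondecreasing M2.cdf_nondecreasing)
  then show "cdf M1 = cdf M2"
    using eq right_continuous_le_if_eq_on_Rats[OF M1.cdf_is_right_cont, of "cdf M2"]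
      right_continuous_le_if_eq_on_Rats[OF M2.cdf_is_right_cont, of "cdf M1"]
    by (intro ext antisym) auto
qed fact+

lemma indep_rv_distr_pair:
  assumes "prob_space M" and [measurable]: "A \<in> borel_measurable M" "B \<in> borel_measurable M"
    and indep: "indep_rv M A B"
  shows "distr M borel B \<Otimes>\<^sub>M distr M borel A = distr M (borel \<Otimes>\<^sub>M borel) (\<lambda>\<omega>. (B \<omega>, A \<omega>))"
proof (rule pair_measure_eqI)
  interpret prob_space M by fact
  show "sigma_finite_measure (distr M borel B)" "sigma_finite_measure (distr M borel A)"
    by (auto intro!: prob_space_distr prob_space_imp_sigma_finite)
  show "sets (distr M borel B \<Otimes>\<^sub>M distr M borel A) =
      sets (distr M (borel \<Otimes>\<^sub>M borel) (\<lambda>\<omega>. (B \<omega>, A \<omega>)))"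
    by (simp cong: sets_pair_measure_cong)
  fix S T assume "S \<in> sets (distr M borel B)" "T \<in> sets (distr M borel A)"
  then have [measurable]: "S \<in> sets borel" "T \<in> sets borel" by auto
  have "prob ((A -` T \<inter> space M) \<inter> (B -` S \<inter> space M)) =
      prob (A -` T \<inter> space M) * prob (B -` S \<inter> space M)"
    by (rule indep_setD[OF indep[unfolded indep_rv_def]])
      (auto intro!: in_vimage_algebra)
  also have "(A -` T \<inter> space M) \<inter> (B -` S \<inter> space M) =
      (\<lambda>\<omega>. (B \<omega>, A \<omega>)) -` (S \<times> T) \<inter> space M"
    by auto
  finally show "emeasure (distr M borel B) S * emeasure (distr M borel A) T =
      emeasure (distr M (borel \<Otimes>\<^sub>M borel) (\<lambda>\<omega>. (B \<omega>, A \<omega>))) (S \<times> T)"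
    by (simp add: emeasure_distr emeasure_eq_measure ennreal_mult' mult.commute)
qed

text \<open>For a fixed threshold \<open>q\<close>, both sides, evaluated on \<open>{..q}\<close>,
  are densities with respect to the law of \<open>W\<close> of the same measure, which sends
  \<open>B\<close> to the probability of \<open>Y \<le> q\<close> and \<open>W \<in> B\<close>.
  Densities are unique almost everywhere.\<close>

lemma regular_cond_distr_indep_noise:
  fixes W :: "'w \<Rightarrow> 'b::topological_space" and E :: "'w \<Rightarrow> 'e::topological_space"
  assumes M: "prob_space M"
    and W [measurable]: "W \<in> borel_measurable M" and E [measurable]: "E \<in> borel_measurable M"
    and indep: "indep_rv M E W"
    and f [measurable]: "(\<lambda>(w, e). f w e) \<in> borel_measurable (borel \<Otimes>\<^sub>M borel)"
    and Y: "\<And>\<omega>. \<omega> \<in> space M \<Longrightarrow> Y \<omega> = f (W \<omega>) (E \<omega>)"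
    and K: "regular_cond_distr M Y W K"
  shows "AE w in distr M borel W. K w = distr (distr M borel E) borel (f w)"
proof -
  interpret prob_space M by fact
  let ?W = "distr M borel W" and ?E = "distr M borel E"
  interpret PW: prob_space ?W by (rule prob_space_distr) simp
  interpret PE: prob_space ?E by (rule prob_space_distr) simp
  have K_kernel: "K \<in> borel \<rightarrow>\<^sub>M prob_algebra borel"
    using K by (simp add: regular_cond_distr_def)
  have K_distribution: "real_distribution (K w)" for w
    using measurable_space[OF K_kernel, of w]
    by (auto simp: space_prob_algebra real_distribution_def real_distribution_axioms_def)
  have f_section [measurable]: "f w \<in> borel_measurable borel" for w
    using measurable_compose[OF measurable_Pair1' f, of w] by simp
  have L_distribution: "real_distribution (distr ?E borel (f w))" for w
    by (auto simp: real_distribution_def real_distribution_axioms_def intro!: PE.prob_space_distr)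
  have "AE w in ?W. emeasure (K w) {..q} = emeasure (distr ?E borel (f w)) {..q}" for q
  proof (rule PW.density_unique)
    show K_meas: "(\<lambda>w. emeasure (K w) {..q}) \<in> borel_measurable ?W"
      using measurable_compose[OF measurable_prob_algebraD[OF K_kernel]
          measurable_emeasure_subprob_algebra, of "{..q}"] by simp
    have "{p \<in> space (borel \<Otimes>\<^sub>M borel). (\<lambda>(w, e). f w e) p \<le> q} \<in> sets (borel \<Otimes>\<^sub>M borel)"
      by measurable
    then have D: "{p. f (fst p) (snd p) \<le> q} \<in> sets (borel \<Otimes>\<^sub>M borel)"
      by (simp add: space_pair_measure case_prod_beta)
    \<comment> \<open>As the measure of a section, this quantity is measurable in \<open>w\<close>
      and is the inner integral in Fubini's theorem.\<close>
    have L: "emeasure (distr ?E borel (f w)) {..q} = emeasure ?E (Pair w -` {p. f (fst p) (snd p) \<le> q})" for w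
      by (subst emeasure_distr) (auto intro!: arg_cong[where f="emeasure ?E"])
    show L_meas: "(\<lambda>w. emeasure (distr ?E borel (f w)) {..q}) \<in> borel_measurable ?W"
      unfolding L by (rule PE.measurable_emeasure_Pair) (use D in \<open>simp cong: sets_pair_measure_cong\<close>)
    show "density ?W (\<lambda>w. emeasure (K w) {..q}) =
        density ?W (\<lambda>w. emeasure (distr ?E borel (f w)) {..q})"
    proof (rule measure_eqI)
      fix B assume "B \<in> sets (density ?W (\<lambda>w. emeasure (K w) {..q}))"
      then have B [measurable]: "B \<in> sets borel" by simp
      let ?S = "{p. f (fst p) (snd p) \<le> q} \<inter> (B \<times> UNIV)"
      have S: "?S \<in> sets (borel \<Otimes>\<^sub>M borel)"
        using D by (intro sets.Int) auto
      have "emeasure (density ?W (\<lambda>w. emeasure (K w) {..q})) B =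
          emeasure M {\<omega> \<in> space M. Y \<omega> \<in> {..q} \<and> W \<omega> \<in> B}"
        using K[unfolded regular_cond_distr_def, THEN conjunct2, rule_format, of "{..q}" B] B K_meas
        by (simp add: emeasure_density)
      also have "\<dots> = emeasure (distr M (borel \<Otimes>\<^sub>M borel) (\<lambda>\<omega>. (W \<omega>, E \<omega>))) ?S"
        using S by (subst emeasure_distr) (auto intro!: arg_cong[where f="emeasure M"] simp: Y)
      \<comment> \<open>Independence enters here: the joint law of \<open>W\<close> and
        \<open>E\<close> is the product of their laws.\<close>
      also have "\<dots> = (\<integral>\<^sup>+ w. emeasure ?E (Pair w -` ?S) \<partial>?W)"
        unfolding indep_rv_distr_pair[OF M E W indep, symmetric]
        by (rule PE.emeasure_pair_measure_alt) (use S in \<open>simp cong: sets_pair_measure_cong\<close>)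
      also have "\<dots> = (\<integral>\<^sup>+ w. emeasure (distr ?E borel (f w)) {..q} * indicator B w \<partial>?W)"
        unfolding L by (intro nn_integral_cong) (auto simp: indicator_def vimage_def)
      also have "\<dots> = emeasure (density ?W (\<lambda>w. emeasure (distr ?E borel (f w)) {..q})) B"
        using L_meas B by (simp add: emeasure_density)
      finally show "emeasure (density ?W (\<lambda>w. emeasure (K w) {..q})) B =
          emeasure (density ?W (\<lambda>w. emeasure (distr ?E borel (f w)) {..q})) B" .
    qed simp
  qed
  \<comment> \<open>The exceptional null set depends on \<open>q\<close>; the union over all
    rational \<open>q\<close> is still a null set.\<close>
  then have "AE w in ?W. \<forall>q\<in>\<rat>. emeasure (K w) {..q} = emeasure (distr ?E borel (f w)) {..q}"
    by (intro AE_ball_countable' countable_rat)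
  then show ?thesis
  proof eventually_elim
    case (elim w)
    then show ?case
      by (intro real_distribution_eqI_Rats K_distribution L_distribution) (simp add: cdf_def measure_def)
  qed
qed

section \<open>Transfer of quantiles\<close>

text \<open>The level carries over because both functions have the same sublevel sets at attained
  values. Minimality is the delicate part: a competitor \<open>\<nu>\<close> need not be a value of
  \<open>\<psi>\<close>, so it may have no counterpart on the side of \<open>\<phi>\<close>.\<close>

lemma is_quantile_distr_transfer:
  fixes P :: "'e::euclidean_space measure" and \<phi> \<psi> :: "'e \<Rightarrow> real"
  assumes P: "prob_space P" and sets_P [measurable_cong]: "sets P = sets borel"
    and [measurable]: "\<phi> \<in> borel_measurable borel" and cont: "continuous_on UNIV \<psi>"
    and order: "\<And>a b. \<phi> a < \<phi> b \<longleftrightarrow> \<psi> a < \<psi> b"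
    and quantile: "is_quantile (distr P borel \<phi>) \<tau> (\<phi> e)"
  shows "is_quantile (distr P borel \<psi>) \<tau> (\<psi> e)"
proof -
  interpret P: prob_space P by fact
  have [measurable]: "\<psi> \<in> borel_measurable borel"
    using cont by (rule borel_measurable_continuous_onI)
  interpret \<phi>: real_distribution "distr P borel \<phi>"
    by (auto simp: real_distribution_def real_distribution_axioms_def intro!: P.prob_space_distr)
  interpret \<psi>: real_distribution "distr P borel \<psi>"
    by (auto simp: real_distribution_def real_distribution_axioms_def intro!: P.prob_space_distr)
  have cdf_\<psi>: "cdf (distr P borel \<psi>) t = measure P {a \<in> space P. \<psi> a \<le> t}" for t
    unfolding cdf_def by (subst measure_distr) (auto intro!: arg_cong[where f="measure P"])
  have cdf_\<phi>: "cdf (distr P borel \<phi>) t = measure P {a \<in> space P. \<phi> a \<le> t}" for t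
    unfolding cdf_def by (subst measure_distr) (auto intro!: arg_cong[where f="measure P"])
  have cdf_eq: "cdf (distr P borel \<psi>) (\<psi> a) = cdf (distr P borel \<phi>) (\<phi> a)" for a
    unfolding cdf_\<psi> cdf_\<phi> by (simp add: order flip: not_less)
  have \<tau>: "cdf (distr P borel \<phi>) (\<phi> e) = \<tau>"
    and least: "\<And>\<nu>. cdf (distr P borel \<phi>) \<nu> = \<tau> \<Longrightarrow> \<phi> e \<le> \<nu>"
    using quantile by (auto simp: is_quantile_def)
  have "\<psi> e \<le> \<nu>" if \<nu>: "cdf (distr P borel \<psi>) \<nu> = \<tau>" for \<nu>
  proof (rule ccontr)
    assume less: "\<not> \<psi> e \<le> \<nu>"
    show False
    proof (cases "\<exists>a. \<nu> \<le> \<psi> a \<and> \<psi> a < \<psi> e")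
      case True
      then obtain a where a: "\<nu> \<le> \<psi> a" "\<psi> a < \<psi> e" by blast
      \<comment> \<open>The value \<open>\<psi> a\<close> lies between two points of level
        \<open>\<tau>\<close>. The corresponding \<open>\<phi> a\<close> then has level
        \<open>\<tau>\<close> too and is smaller than \<open>\<phi> e\<close>.\<close>
      have "cdf (distr P borel \<psi>) (\<psi> a) = \<tau>"
        using \<psi>.cdf_nondecreasing[OF a(1)] \<psi>.cdf_nondecreasing[of "\<psi> a" "\<psi> e"] a(2) \<nu> \<tau> cdf_eq[of e]
        by simp
      then show False
        using least[of "\<phi> a"] cdf_eq[of a] order[of a e] a(2) by simp
    next
      case False
      \<comment> \<open>Otherwise \<open>\<nu>\<close> would lie between two values of
        \<open>\<psi>\<close>, hence be a value itself, which the current case excludes. So the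
        event \<open>\<psi> a \<le> \<nu>\<close> is empty.\<close>
      have "\<nu> < \<psi> a" for a
      proof (rule ccontr)
        assume "\<not> \<nu> < \<psi> a"
        then have "\<nu> \<in> range \<psi>"
          using connectedD_interval[OF connected_continuous_image[OF cont connected_UNIV], of "\<psi> a" "\<psi> e" \<nu>]
            less by auto
        then show False
          using False less by auto
      qed
      then have "\<tau> = 0"
        using \<nu> by (simp add: cdf_\<psi> not_le[symmetric])
      \<comment> \<open>The distribution function stays \<open>0\<close> to the left, so there is no least \<open>0\<close>-quantile.\<close>
      then have "cdf (distr P borel \<phi>) (\<phi> e - 1) = \<tau>"
        using \<phi>.cdf_nondecreasing[of "\<phi> e - 1" "\<phi> e"] \<phi>.cdf_nonneg[of "\<phi> e - 1"] \<tau> by simp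
      then show False
        using least[of "\<phi> e - 1"] by simp
    qed
  qed
  then show ?thesis
    using \<tau> cdf_eq[of e] by (simp add: is_quantile_def)
qed

text \<open>The intervention overrides the equation of \<open>X\<close>, so \<open>u\<close> matters
  only through its compatibility with the evidence.\<close>

lemma counterfactual_outcomes_alt:
  "counterfactual_outcomes m x y z x' =
    {eqn_Y m x' z e | u e. eqn_X m z u = x \<and> eqn_Y m x z e = y}"
  unfolding counterfactual_outcomes_def abduction_def outcome_def do_X_def by force

theorem theorem1:
  fixes M :: "'w measure"
    and m :: "('x::euclidean_space, 'z::euclidean_space, 'u, 'e::euclidean_space) scm"
    and X :: "'w \<Rightarrow> 'x" and Z :: "'w \<Rightarrow> 'z" and Y :: "'w \<Rightarrow> real"
    and U :: "'w \<Rightarrow> 'u" and E :: "'w \<Rightarrow> 'e"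
    and g :: "'e \<Rightarrow> real"
    and K :: "'x \<times> 'z \<Rightarrow> real measure"
  assumes "prob_space M"
    and "X \<in> borel_measurable M" and "Z \<in> borel_measurable M"
    and "Y \<in> borel_measurable M" and "E \<in> borel_measurable M"
    and "\<And>\<omega>. \<omega> \<in> space M \<Longrightarrow> X \<omega> = eqn_X m (Z \<omega>) (U \<omega>)"
    and "\<And>\<omega>. \<omega> \<in> space M \<Longrightarrow> Y \<omega> = eqn_Y m (X \<omega>) (Z \<omega>) (E \<omega>)"
    and "indep_rv M E (\<lambda>\<omega>. (X \<omega>, Z \<omega>))"
    and "smooth (\<lambda>(x, z, e). eqn_Y m x z e)"
    and "strictly_monotonic_in_noise (eqn_Y m) g"
    and "regular_cond_distr M Y (\<lambda>\<omega>. (X \<omega>, Z \<omega>)) K"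
  shows "\<exists>N \<in> null_sets (distr M borel (\<lambda>\<omega>. (X \<omega>, Z \<omega>))).
    \<forall>x y z x' \<tau>.
      (x, z) \<notin> N \<longrightarrow> (x', z) \<notin> N \<longrightarrow>
      abduction m x y z \<noteq> {} \<longrightarrow>
      is_quantile (K (x, z)) \<tau> y \<longrightarrow>
      (\<exists>y'. counterfactual_outcomes m x y z x' = {y'} \<and> is_quantile (K (x', z)) \<tau> y')"
proof -
  interpret prob_space M by fact
  let ?W = "\<lambda>\<omega>. (X \<omega>, Z \<omega>)"
  let ?f = "\<lambda>w e. eqn_Y m (fst w) (snd w) e"
  let ?P = "distr M borel E"
  have [measurable]: "X \<in> borel_measurable M" "Z \<in> borel_measurable M" "E \<in> borel_measurable M"
    by fact+
  have W: "?W \<in> borel_measurable M"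
    by measurable
  have cont: "continuous_on UNIV (\<lambda>(x, z, e). eqn_Y m x z e)"
    using assms(9) Ck.simps(1) unfolding smooth_def by blast
  have "continuous_on UNIV (\<lambda>(w, e). ?f w e)"
    unfolding case_prod_beta
    using continuous_on_compose2[OF cont _ subset_UNIV, of UNIV "\<lambda>p. (fst (fst p), snd (fst p), snd p)"]
    by (simp add: continuous_intros)
  then have f: "(\<lambda>(w, e). ?f w e) \<in> borel_measurable (borel \<Otimes>\<^sub>M borel)"
    unfolding borel_prod by (rule borel_measurable_continuous_onI)
  have cont_e: "continuous_on UNIV (eqn_Y m x z)" for x z
    using continuous_on_compose2[OF cont _ subset_UNIV, of UNIV "\<lambda>e. (x, z, e)"]
    by (simp add: continuous_intros)
  have order: "eqn_Y m x z a < eqn_Y m x z b \<longleftrightarrow> eqn_Y m x' z' a < eqn_Y m x' z' b" for x z x' z' a b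
    using noise_order_invariant[OF assms(10) cont] by blast
  have "AE w in distr M borel ?W. K w = distr ?P borel (?f w)"
    by (rule regular_cond_distr_indep_noise[OF assms(1) W assms(5,8) f _ assms(11)])
      (simp add: assms(7))
  \<comment> \<open>\<open>N\<close> is fixed before the evidence and \<open>x'\<close>, so one
    exceptional set serves them all.\<close>
  then obtain N where N: "N \<in> null_sets (distr M borel ?W)"
    and "{w. K w \<noteq> distr ?P borel (?f w)} \<subseteq> N"
    unfolding eventually_ae_filter space_distr space_borel by blast
  then have K: "K w = distr ?P borel (?f w)" if "w \<notin> N" for w
    using that by blast
  show ?thesis
  proof (intro bexI[OF _ N] allI impI)
    fix x y z x' \<tau>
    assume notin: "(x, z) \<notin> N" "(x', z) \<notin> N" and "abduction m x y z \<noteq> {}"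
      and quantile: "is_quantile (K (x, z)) \<tau> y"
    then obtain u e where ue: "eqn_X m z u = x" "eqn_Y m x z e = y"
      by (auto simp: abduction_def outcome_def)
    \<comment> \<open>Abduction may leave several noise values. They tie at \<open>(x, z)\<close>,
      and by \<open>order\<close> a tie at \<open>(x, z)\<close> is a tie at \<open>(x', z)\<close>,
      so prediction is single-valued.\<close>
    have unique: "eqn_Y m x' z e' = eqn_Y m x' z e" if "eqn_Y m x z e' = y" for e'
      using order[of x z e e' x' z] order[of x z e' e x' z] that ue(2) by simp
    have "counterfactual_outcomes m x y z x' = {eqn_Y m x' z e}"
    proof (intro equalityI subsetI)
      fix t assume "t \<in> counterfactual_outcomes m x y z x'"
      then obtain e' where "t = eqn_Y m x' z e'" "eqn_Y m x z e' = y"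
        unfolding counterfactual_outcomes_alt by blast
      then show "t \<in> {eqn_Y m x' z e}"
        using unique[of e'] by simp
    next
      fix t assume "t \<in> {eqn_Y m x' z e}"
      then show "t \<in> counterfactual_outcomes m x y z x'"
        unfolding counterfactual_outcomes_alt using ue by blast
    qed
    moreover have "is_quantile (distr ?P borel (eqn_Y m x' z)) \<tau> (eqn_Y m x' z e)"
    proof (rule is_quantile_distr_transfer)
      show "prob_space ?P"
        by (rule prob_space_distr) simp
      show "eqn_Y m x z \<in> borel_measurable borel"
        by (rule borel_measurable_continuous_onI[OF cont_e])
      show "continuous_on UNIV (eqn_Y m x' z)"
        by (rule cont_e)
      show "eqn_Y m x z a < eqn_Y m x z b \<longleftrightarrow> eqn_Y m x' z a < eqn_Y m x' z b" for a b
        by (rule order)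
      show "is_quantile (distr ?P borel (eqn_Y m x z)) \<tau> (eqn_Y m x z e)"
        using quantile K[OF notin(1)] ue(2) by simp
    qed simp
    then have "is_quantile (K (x', z)) \<tau> (eqn_Y m x' z e)"
      using K[OF notin(2)] by (simp only: fst_conv snd_conv)
    ultimately show "\<exists>y'. counterfactual_outcomes m x y z x' = {y'} \<and> is_quantile (K (x', z)) \<tau> y'"
      by (intro exI conjI)
  qed
qed

end
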